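(* Let $d\in\mathbb{N}$ and let $\xi,\xi_1,\xi_2,\ldots$ be i.i.d. random variables in $\mathbb{R}^d$ with $\mathbb{E}\xi=0$ and $\mathbb{E}[\|\xi\|^2]<\infty$. Let $\Sigma:=\mathbb{E}[\xi\xi^{\top}]$, $S_n:=\sum_{i=1}^n\xi_i$, $G_0:=0$ and $G_n:=\frac1n\sum_{i=1}^nS_i$ for $n\ge1$. Let $t\in[0,1]$. Then $$\frac1{\sqrt n}G_{\lfloor nt\rfloor}\to\mathcal{N}\Big(0,\frac{t\Sigma}{3}\Big)\quad\text{in distribution, as }n\to\infty.$$
   Context: $\mathcal{N}(m,K)$ denotes the $d$-dimensional normal distribution with mean $m$ and covariance matrix $K$ (possibly singular); $\mathcal{N}(m,0)$ is the point mass at $m$. *)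

theory Defs
  imports "HOL-Probability.Probability"
begin

definition outer_product :: "real ^ 'n \<Rightarrow> real ^ 'n ^ 'n" where
  "outer_product x = (\<chi> i j. x $ i * x $ j)"

definition iid :: "'s measure \<Rightarrow> (nat \<Rightarrow> 's \<Rightarrow> 'a::topological_space) \<Rightarrow> bool" where
  "iid M X \<longleftrightarrow> prob_space.indep_vars M (\<lambda>_. borel) X UNIV \<and>
    (\<forall>i j. distr M borel (X i) = distr M borel (X j))"

text \<open>
  The law of \<open>m + A Z\<close>, where \<open>Z\<close> has independent standard normal coordinates and
  \<open>A A\<^sup>T = K\<close>. Such an \<open>A\<close> exists exactly when \<open>K\<close> is symmetric and positive semidefinite
  (\<open>K\<close> may be singular), and then the law does not depend on the choice of \<open>A\<close>.
  For other \<open>K\<close> the value is unspecified.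
\<close>

definition multivariate_normal :: "real ^ 'n \<Rightarrow> real ^ 'n ^ 'n \<Rightarrow> (real ^ 'n) measure" where
  "multivariate_normal m K =
    (let A = (SOME A :: real ^ 'n ^ 'n. A ** transpose A = K)
     in distr (Pi\<^sub>M UNIV (\<lambda>_ :: 'n. std_normal_distribution)) borel
          (\<lambda>z. m + A *v (\<chi> i. z i)))"

lemma multivariate_normal_0: "multivariate_normal m 0 = return borel (m :: real ^ 'n)"
proof -
  let ?A = "SOME A :: real ^ 'n ^ 'n. A ** transpose A = 0"
  have "(0 :: real ^ 'n ^ 'n) ** transpose 0 = 0"
    by simp
  then have *: "?A ** transpose ?A = 0"
    by (rule someI)
  have "row i ?A = 0" for i
  proof -
    have "row i ?A \<bullet> row i ?A = (?A ** transpose ?A) $ i $ i"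
      by (simp add: matrix_matrix_mult_def transpose_def row_def inner_vec_def)
    with * show ?thesis by simp
  qed
  then have A: "?A = 0"
    by (simp add: row_def vec_eq_iff)
  interpret prob_space "Pi\<^sub>M UNIV (\<lambda>_ :: 'n. std_normal_distribution)"
    by (intro prob_space_PiM real_distribution.axioms(1) real_dist_normal_dist)
  show ?thesis
    unfolding multivariate_normal_def Let_def A by (simp add: distr_const)
qed

text \<open>
  Weak convergence of the laws, in the bounded-continuous-test-function form; the library
  notion \<open>weak_conv_m\<close>, based on distribution functions, is confined to measures on \<open>real\<close>.
\<close>

definition converges_in_distribution ::
    "'s measure \<Rightarrow> (nat \<Rightarrow> 's \<Rightarrow> 'a::topological_space) \<Rightarrow> 'a measure \<Rightarrow> bool" where
  "converges_in_distribution M Y \<mu> \<longleftrightarrow>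
    (\<forall>f :: 'a \<Rightarrow> real. continuous_on UNIV f \<and> bounded (range f) \<longrightarrow>
       (\<lambda>n. integral\<^sup>L (distr M borel (Y n)) f) \<longlonglongrightarrow> integral\<^sup>L \<mu> f)"

definition random_walk :: "(nat \<Rightarrow> 's \<Rightarrow> real ^ 'n) \<Rightarrow> nat \<Rightarrow> 's \<Rightarrow> real ^ 'n" where
  "random_walk X n \<omega> = (\<Sum>i = 1..n. X i \<omega>)"

definition centre_of_mass :: "(nat \<Rightarrow> 's \<Rightarrow> real ^ 'n) \<Rightarrow> nat \<Rightarrow> 's \<Rightarrow> real ^ 'n" where
  "centre_of_mass X n \<omega> =
    (if n = 0 then 0 else (1 / real n) *\<^sub>R (\<Sum>i = 1..n. random_walk X i \<omega>))"

end

theory Submission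
  imports Defs
begin

text \<open>
  The centre of mass is a weighted sum of the increments, with weights
  \<open>(m + 1 - i) / m\<close> for \<open>1 \<le> i \<le> m\<close>, whose squares add up to \<open>m / 3 + O(1)\<close>. Hence for each \<open>u\<close>
  the characteristic function of the rescaled centre of mass at \<open>u\<close> is a product of characteristic
  functions of \<open>u \<bullet> \<xi>\<close> at uniformly small arguments, and a second-order expansion compares it with
  a product of Gaussian ones. The passage to weak convergence in \<open>\<real>\<^sup>d\<close> approximates a bounded
  continuous function on a large box by a trigonometric polynomial that is globally bounded;
  tightness comes from the one-dimensional continuity theorem for the coordinates.
\<close>

section \<open>Trigonometric polynomials\<close>

text \<open>Arbitrary real frequencies are allowed, so multiplying monomials just adds frequencies
  and no period has to be fixed when the approximation box grows.\<close>

inductive trig_poly :: "('a::real_inner \<Rightarrow> complex) \<Rightarrow> bool" where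
  monomial: "trig_poly (\<lambda>x. a * cis (u \<bullet> x))"
| add: "trig_poly f \<Longrightarrow> trig_poly g \<Longrightarrow> trig_poly (\<lambda>x. f x + g x)"

lemma trig_poly_const: "trig_poly (\<lambda>x. a)"
  using trig_poly.monomial[of a 0] by simp

lemma trig_poly_mult:
  assumes "trig_poly f" "trig_poly g"
  shows "trig_poly (\<lambda>x. f x * g x)"
  using assms(2)
proof induction
  case (monomial b v)
  show ?case
    using assms(1)
  proof induction
    case (monomial a u)
    have "(\<lambda>x. a * cis (u \<bullet> x) * (b * cis (v \<bullet> x))) = (\<lambda>x. (a * b) * cis ((u + v) \<bullet> x))"
      by (simp add: inner_add_left cis_mult[symmetric] mult_ac)
    then show ?case
      by (simp only: trig_poly.monomial)
  next
    case (add f g)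
    then show ?case
      by (simp only: distrib_right trig_poly.add)
  qed
next
  case (add g h)
  then show ?case
    by (simp only: distrib_left trig_poly.add)
qed

lemma trig_poly_sum:
  assumes "\<And>i. i \<in> I \<Longrightarrow> trig_poly (f i)"
  shows "trig_poly (\<lambda>x. \<Sum>i\<in>I. f i x)"
  using assms by (induction I rule: infinite_finite_induct) (auto intro: trig_poly_const trig_poly.add)

lemma trig_poly_sin: "trig_poly (\<lambda>x. of_real (sin (u \<bullet> x)))"
proof -
  have "(\<lambda>x. of_real (sin (u \<bullet> x))) =
      (\<lambda>x. (- \<i> / 2) * cis (u \<bullet> x) + (\<i> / 2) * cis ((- u) \<bullet> x))"
    by (auto simp: complex_eq_iff)
  then show ?thesis
    by (simp only: trig_poly.intros)
qed

lemma trig_poly_continuous: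
  assumes "trig_poly f"
  shows "continuous_on UNIV f"
  using assms by induction (auto intro!: continuous_intros continuous_on_cis)

lemma trig_poly_bounded:
  assumes "trig_poly f"
  shows "\<exists>B. \<forall>x. norm (f x) \<le> B"
  using assms
proof induction
  case (monomial a u)
  then show ?case by (auto simp: norm_mult)
next
  case (add f g)
  then show ?case by (meson add_mono norm_triangle_le)
qed

text \<open>Each coordinate of the inner map is a sine, hence a trigonometric polynomial, and the
  class is closed under sums and products. This converts the polynomials supplied by
  Stone-Weierstrass.\<close>

lemma trig_poly_compose_sin:
  fixes p :: "'a::euclidean_space \<Rightarrow> real" and c :: real
  assumes "real_polynomial_function p"
  shows "trig_poly (\<lambda>x. of_real (p (\<Sum>b\<in>Basis. sin (c * (x \<bullet> b)) *\<^sub>R b)))"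
  using assms
proof induction
  case (linear f)
  then interpret bounded_linear f .
  have "trig_poly (\<lambda>x. \<Sum>b\<in>Basis. of_real (sin ((c *\<^sub>R b) \<bullet> x)) * of_real (f b))"
    by (intro trig_poly_sum trig_poly_mult trig_poly_sin trig_poly_const)
  then show ?case
    by (simp add: sum scaleR inner_commute)
next
  case (add f g)
  then show ?case
    by (simp only: of_real_add trig_poly.add)
next
  case (mult f g)
  then show ?case
    by (simp only: of_real_mult trig_poly_mult)
qed (simp add: trig_poly_const)

text \<open>
  \<open>T\<close> maps everything into the unit box \<open>Q\<close> and has left inverse \<open>R\<close> on the given box, so a
  polynomial approximating \<open>f \<circ> R\<close> on \<open>Q\<close> yields, after composition with \<open>T\<close>, a function that is
  close to \<open>f\<close> on the given box and bounded everywhere.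
\<close>

lemma trig_poly_approx_on_box:
  fixes f :: "'a::euclidean_space \<Rightarrow> real"
  assumes f: "continuous_on UNIV f" and B: "\<And>x. \<bar>f x\<bar> \<le> B"
    and "\<epsilon> > 0" "L > 0"
  obtains g where "trig_poly (\<lambda>x. of_real (g x))" "\<And>x. \<bar>g x\<bar> \<le> B + \<epsilon>"
    "\<And>x. (\<And>b. b \<in> Basis \<Longrightarrow> \<bar>x \<bullet> b\<bar> \<le> L) \<Longrightarrow> \<bar>f x - g x\<bar> < \<epsilon>"
proof -
  \<comment> \<open>This factor carries [-L, L] onto [-pi/2, pi/2], where \<open>arcsin\<close>
    inverts \<open>sin\<close>.\<close>
  define c where "c = pi / (2 * L)"
  define T :: "'a \<Rightarrow> 'a" where "T x = (\<Sum>b\<in>Basis. sin (c * (x \<bullet> b)) *\<^sub>R b)" for x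
  define R :: "'a \<Rightarrow> 'a" where "R y = (\<Sum>b\<in>Basis. (arcsin (y \<bullet> b) / c) *\<^sub>R b)" for y
  define Q where "Q = cbox (- One :: 'a) One"
  have "c > 0"
    using \<open>L > 0\<close> by (simp add: c_def)
  have T_in: "T x \<in> Q" for x
    by (simp add: Q_def mem_box T_def)
  have RT: "R (T x) = x" if "\<And>b. b \<in> Basis \<Longrightarrow> \<bar>x \<bullet> b\<bar> \<le> L" for x
  proof (rule euclidean_eqI)
    fix b :: 'a assume b: "b \<in> Basis"
    have "\<bar>c * (x \<bullet> b)\<bar> \<le> c * L"
      unfolding abs_mult using that[OF b] \<open>c > 0\<close> by (intro mult_mono) auto
    also have "c * L = pi / 2"
      using \<open>L > 0\<close> by (simp add: c_def)
    finally have "arcsin (sin (c * (x \<bullet> b))) = c * (x \<bullet> b)"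
      by (intro arcsin_sin) (auto simp: abs_le_iff)
    then show "R (T x) \<bullet> b = x \<bullet> b"
      using b \<open>c > 0\<close> by (simp add: R_def T_def)
  qed
  have "continuous_on Q (\<lambda>y. f (R y))"
  proof (rule continuous_on_compose2[OF f])
    show "continuous_on Q R"
      unfolding R_def Q_def using \<open>c > 0\<close>
      by (intro continuous_intros ballI) (auto simp: mem_box)
  qed auto
  then obtain p where p: "real_polynomial_function p" "\<And>y. y \<in> Q \<Longrightarrow> \<bar>f (R y) - p y\<bar> < \<epsilon>"
    using Stone_Weierstrass_real_polynomial_function[of Q "\<lambda>y. f (R y)" \<epsilon>] \<open>\<epsilon> > 0\<close>
    by (auto simp: Q_def)
  show thesis
  proof (rule that[of "\<lambda>x. p (T x)"])
    show "trig_poly (\<lambda>x. of_real (p (T x)))"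
      unfolding T_def by (rule trig_poly_compose_sin[OF p(1)])
    \<comment> \<open>\<open>T x\<close> lies in \<open>Q\<close> for every \<open>x\<close>, so
      \<open>p\<close> is still close to \<open>f\<close> at \<open>R (T x)\<close>, even outside
      the box, where \<open>R (T x)\<close> may differ from \<open>x\<close>.\<close>
    show "\<bar>p (T x)\<bar> \<le> B + \<epsilon>" for x
      using p(2)[OF T_in[of x]] B[of "R (T x)"] by linarith
    show "\<bar>f x - p (T x)\<bar> < \<epsilon>" if "\<And>b. b \<in> Basis \<Longrightarrow> \<bar>x \<bullet> b\<bar> \<le> L" for x
      using p(2)[OF T_in[of x]] RT[OF that] by simp
  qed
qed

section \<open>The continuity theorem in Euclidean spaces\<close>

lemma integrable_continuous_bounded:
  fixes f :: "'a::topological_space \<Rightarrow> 'b::{banach, second_countable_topology}"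
  assumes "finite_measure M" "sets M = sets borel" "continuous_on UNIV f" "\<And>x. norm (f x) \<le> B"
  shows "integrable M f"
proof (rule finite_measure.integrable_const_bound[OF assms(1)])
  show "f \<in> borel_measurable M"
    using borel_measurable_continuous_onI[OF assms(3)] assms(2)
    by (simp cong: measurable_cong_sets)
  show "AE x in M. norm (f x) \<le> B"
    using assms(4) by simp
qed

text \<open>A continuous substitute for the indicator of the complement of a box: it vanishes on the
  box of half-width \<open>k\<close> and is at least 1 off the box of half-width
  \<open>k + 1\<close>. Being a sum over coordinates, its integral depends on the one-dimensional
  marginals only.\<close>

definition tail_ramp :: "real \<Rightarrow> 'a::euclidean_space \<Rightarrow> real" where
  "tail_ramp k x = (\<Sum>b\<in>Basis. min 1 (max 0 (\<bar>x \<bullet> b\<bar> - k)))"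

lemma continuous_on_tail_ramp: "continuous_on S (tail_ramp k)"
  unfolding tail_ramp_def by (intro continuous_intros)

lemma tail_ramp_nonneg: "0 \<le> tail_ramp k x"
  unfolding tail_ramp_def by (intro sum_nonneg) auto

lemma tail_ramp_le: "tail_ramp k (x :: 'a::euclidean_space) \<le> DIM('a)"
  unfolding tail_ramp_def by (rule order_trans[OF sum_bounded_above[where K = 1]]) auto

lemma tail_ramp_ge_1:
  assumes "b \<in> Basis" "k + 1 \<le> \<bar>x \<bullet> b\<bar>"
  shows "1 \<le> tail_ramp k x"
proof -
  have "1 = min 1 (max 0 (\<bar>x \<bullet> b\<bar> - k))"
    using assms(2) by auto
  also have "\<dots> \<le> tail_ramp k x"
    unfolding tail_ramp_def using assms(1) by (intro member_le_sum) auto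
  finally show ?thesis .
qed

lemma tail_ramp_tendsto_0: "(\<lambda>k. tail_ramp (real k) x) \<longlonglongrightarrow> 0"
proof (rule tendsto_eventually)
  have "tail_ramp (real k) x = 0" if "nat \<lceil>norm x\<rceil> \<le> k" for k
  proof -
    have "\<bar>x \<bullet> b\<bar> \<le> real k" if "b \<in> Basis" for b
      using Basis_le_norm[OF that, of x] \<open>nat \<lceil>norm x\<rceil> \<le> k\<close> by linarith
    then show ?thesis
      unfolding tail_ramp_def by (intro sum.neutral) auto
  qed
  then show "\<forall>\<^sub>F k in sequentially. tail_ramp (real k) x = 0"
    unfolding eventually_sequentially by blast
qed

text \<open>The setting of Levy's continuity theorem with the limit law given in advance; tightness
  is not assumed but recovered from the marginals.\<close>

locale char_convergence =
  fixes \<nu> :: "nat \<Rightarrow> 'a::euclidean_space measure" and \<mu> :: "'a measure"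
  assumes prob_\<nu>: "prob_space (\<nu> n)" and sets_\<nu> [measurable_cong]: "sets (\<nu> n) = sets borel"
    and prob_\<mu>: "prob_space \<mu>" and sets_\<mu> [measurable_cong]: "sets \<mu> = sets borel"
    and char_tendsto: "(\<lambda>n. \<integral>x. cis (u \<bullet> x) \<partial>\<nu> n) \<longlonglongrightarrow> (\<integral>x. cis (u \<bullet> x) \<partial>\<mu>)"
begin

lemma integral_trig_poly_tendsto:
  assumes "trig_poly g"
  shows "(\<lambda>n. \<integral>x. g x \<partial>\<nu> n) \<longlonglongrightarrow> (\<integral>x. g x \<partial>\<mu>)"
  using assms
proof induction
  case (monomial a u)
  then show ?case
    by (simp add: tendsto_mult_left char_tendsto)
next
  case (add f g)
  have "integrable (\<nu> n) h" "integrable \<mu> h" if h: "trig_poly h" for h n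
    using integrable_continuous_bounded[OF prob_space.finite_measure[OF prob_\<nu>] sets_\<nu> trig_poly_continuous[OF h]]
      integrable_continuous_bounded[OF prob_space.finite_measure[OF prob_\<mu>] sets_\<mu> trig_poly_continuous[OF h]]
      trig_poly_bounded[OF h]
    by blast+
  with add show ?case
    by (simp add: tendsto_add)
qed

text \<open>The characteristic function of the projection along \<open>b\<close> at \<open>t\<close>
  is the joint one at \<open>t *\<^sub>R b\<close>, so the one-dimensional continuity theorem
  applies.\<close>

lemma weak_conv_inner:
  "weak_conv_m (\<lambda>n. distr (\<nu> n) borel (\<lambda>x. x \<bullet> b)) (distr \<mu> borel (\<lambda>x. x \<bullet> b))"
proof (rule levy_continuity)
  have [measurable]: "(\<lambda>x. x \<bullet> b) \<in> borel_measurable borel"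
    by simp
  have "char (distr N borel (\<lambda>x. x \<bullet> b)) t = (\<integral>x. cis ((t *\<^sub>R b) \<bullet> x) \<partial>N)"
    if [measurable_cong]: "sets N = sets borel" for N t
    by (simp add: char_def integral_distr cis_conv_exp inner_commute)
  then show "(\<lambda>n. char (distr (\<nu> n) borel (\<lambda>x. x \<bullet> b)) t) \<longlonglongrightarrow> char (distr \<mu> borel (\<lambda>x. x \<bullet> b)) t" for t
    using char_tendsto[of "t *\<^sub>R b"] by (simp only: sets_\<nu> sets_\<mu>)
qed (auto intro!: prob_space.real_distribution_distr prob_\<nu> prob_\<mu>)

lemma integrable_tail_ramp: "integrable (\<nu> n) (tail_ramp k)" "integrable \<mu> (tail_ramp k)"
  by (auto intro!: integrable_continuous_bounded[where B = "DIM('a)"] prob_space.finite_measure prob_\<nu> prob_\<mu>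
      sets_\<nu> sets_\<mu> continuous_on_tail_ramp simp: tail_ramp_nonneg tail_ramp_le)

lemma integral_tail_ramp_tendsto:
  "(\<lambda>n. \<integral>x. tail_ramp k x \<partial>\<nu> n) \<longlonglongrightarrow> (\<integral>x. tail_ramp k x \<partial>\<mu>)"
proof -
  define h where "h s = min 1 (max 0 (\<bar>s\<bar> - k))" for s :: real
  have h: "continuous_on UNIV h" "\<And>s. \<bar>h s\<bar> \<le> 1"
    unfolding h_def by (auto intro!: continuous_intros)
  have hm [measurable]: "h \<in> borel_measurable borel"
    by (intro borel_measurable_continuous_onI h)
  have eq: "(\<integral>x. tail_ramp k x \<partial>N) = (\<Sum>b\<in>Basis. \<integral>s. h s \<partial>distr N borel (\<lambda>x. x \<bullet> b))"
    if N: "prob_space N" and [measurable_cong]: "sets N = sets borel" for N :: "'a measure"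
  proof -
    have "integrable N (\<lambda>x. h (x \<bullet> b))" for b
      using h(2) that
      by (intro integrable_continuous_bounded[where B = 1] prob_space.finite_measure N
          continuous_on_compose2[OF h(1)] continuous_intros) auto
    then show ?thesis
      by (simp add: tail_ramp_def h_def[symmetric] integral_distr)
  qed
  have "(\<lambda>n. \<integral>s. h s \<partial>distr (\<nu> n) borel (\<lambda>x. x \<bullet> b)) \<longlonglongrightarrow> (\<integral>s. h s \<partial>distr \<mu> borel (\<lambda>x. x \<bullet> b))" for b
    using h
    by (intro weak_conv_imp_integral_bdd_continuous_conv[where B = 1] weak_conv_inner
        prob_space.real_distribution_distr prob_\<nu> prob_\<mu>)
      (auto simp: continuous_on_eq_continuous_at)
  then show ?thesis
    by (auto simp: eq[OF prob_\<nu> sets_\<nu>] eq[OF prob_\<mu> sets_\<mu>] intro!: tendsto_sum)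
qed

text \<open>
  Trigonometric polynomials handle a box, and the ramps bound the mass outside it: their
  integrals converge by the one-dimensional continuity theorem for the coordinates.
\<close>

theorem integral_bounded_continuous_tendsto:
  fixes f :: "'a \<Rightarrow> real"
  assumes f: "continuous_on UNIV f" and "bounded (range f)"
  shows "(\<lambda>n. \<integral>x. f x \<partial>\<nu> n) \<longlonglongrightarrow> (\<integral>x. f x \<partial>\<mu>)"
proof (rule LIMSEQ_I)
  fix e :: real assume "e > 0"
  \<comment> \<open>The final estimate costs less than 5 of these units: two for replacing f by g
    under \<open>\<nu> n\<close>, two under \<open>\<mu>\<close>, and one for the integrals of
    g.\<close>
  define \<epsilon> where "\<epsilon> = e / 8"
  have "\<epsilon> > 0" using \<open>e > 0\<close> by (simp add: \<epsilon>_def)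
  obtain B where B: "\<And>x. \<bar>f x\<bar> \<le> B"
    using \<open>bounded (range f)\<close> by (auto simp: bounded_iff)
  have "0 \<le> B"
    using B[of 0] by linarith
  \<comment> \<open>A bound for the distance of f and g everywhere, since they are bounded by
    \<open>B\<close> and \<open>B + \<epsilon>\<close>.\<close>
  define C where "C = 2 * B + \<epsilon>"
  have "(\<lambda>k. \<integral>x. tail_ramp (real k) x \<partial>\<mu>) \<longlonglongrightarrow> (\<integral>x. 0 \<partial>\<mu>)"
  proof (rule integral_dominated_convergence[where w = "\<lambda>_. DIM('a)"])
    interpret prob_space \<mu> by (rule prob_\<mu>)
    show "integrable \<mu> (\<lambda>_. real DIM('a))" by simp
  qed (auto simp: tail_ramp_nonneg tail_ramp_le tail_ramp_tendsto_0
        intro!: borel_measurable_integrable integrable_tail_ramp)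
  then have "(\<lambda>k. C * (\<integral>x. tail_ramp (real k) x \<partial>\<mu>)) \<longlonglongrightarrow> C * 0"
    by (intro tendsto_intros) simp
  then have "\<forall>\<^sub>F k in sequentially. C * (\<integral>x. tail_ramp (real k) x \<partial>\<mu>) < \<epsilon>"
    using \<open>\<epsilon> > 0\<close> by (simp add: order_tendstoD)
  \<comment> \<open>The cutoff is chosen from the limit law alone; convergence of the ramp integrals
    later transfers the bound to \<open>\<nu> n\<close> for large \<open>n\<close>. The box for g
    has half-width \<open>k + 1\<close>, beyond which the ramp is at least 1.\<close>
  then obtain k where k: "C * (\<integral>x. tail_ramp (real k) x \<partial>\<mu>) < \<epsilon>"
    by (auto simp: eventually_sequentially)
  obtain g where g: "trig_poly (\<lambda>x. of_real (g x))" "\<And>x. \<bar>g x\<bar> \<le> B + \<epsilon>"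
    "\<And>x. (\<And>b. b \<in> Basis \<Longrightarrow> \<bar>x \<bullet> b\<bar> \<le> real k + 1) \<Longrightarrow> \<bar>f x - g x\<bar> < \<epsilon>"
    using trig_poly_approx_on_box[OF f B \<open>\<epsilon> > 0\<close>, of "real k + 1"] by auto
  have cont_g: "continuous_on UNIV g"
    using continuous_on_Re[OF trig_poly_continuous[OF g(1)]] by simp
  have fg: "\<bar>f x - g x\<bar> \<le> \<epsilon> + C * tail_ramp k x" for x
  proof (cases "\<forall>b\<in>Basis. \<bar>x \<bullet> b\<bar> \<le> real k + 1")
    case True
    then have "\<bar>f x - g x\<bar> < \<epsilon>" by (intro g(3)) auto
    moreover have "0 \<le> C * tail_ramp k x"
      using \<open>0 \<le> B\<close> \<open>\<epsilon> > 0\<close> by (simp add: C_def tail_ramp_nonneg)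
    ultimately show ?thesis by linarith
  next
    case False
    then have "1 \<le> tail_ramp k x"
      by (auto intro!: tail_ramp_ge_1 simp: not_le)
    then have "C * 1 \<le> C * tail_ramp k x"
      using \<open>0 \<le> B\<close> \<open>\<epsilon> > 0\<close> by (intro mult_left_mono) (auto simp: C_def)
    then show ?thesis
      using B[of x] g(2)[of x] \<open>\<epsilon> > 0\<close> by (simp add: C_def)
  qed
  have int_fg: "\<bar>(\<integral>x. f x \<partial>N) - (\<integral>x. g x \<partial>N)\<bar> \<le> \<epsilon> + C * (\<integral>x. tail_ramp k x \<partial>N)"
    if N: "prob_space N" "sets N = sets borel" and ramp: "integrable N (tail_ramp (real k))" for N
  proof -
    interpret prob_space N by (rule N)
    have [simp]: "integrable N f" "integrable N g"
      using B g(2) by (auto intro!: integrable_continuous_bounded finite_measure_axioms N f cont_g)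
    have "\<bar>(\<integral>x. f x \<partial>N) - (\<integral>x. g x \<partial>N)\<bar> \<le> (\<integral>x. \<bar>f x - g x\<bar> \<partial>N)"
      using integral_abs_bound[of N "\<lambda>x. f x - g x"] by simp
    also have "\<dots> \<le> (\<integral>x. \<epsilon> + C * tail_ramp k x \<partial>N)"
      using ramp fg by (intro integral_mono) auto
    finally show ?thesis
      using ramp by (simp add: prob_space)
  qed
  have "(\<lambda>n. C * (\<integral>x. tail_ramp k x \<partial>\<nu> n)) \<longlonglongrightarrow> C * (\<integral>x. tail_ramp k x \<partial>\<mu>)"
    by (intro tendsto_intros integral_tail_ramp_tendsto)
  then have ev1: "\<forall>\<^sub>F n in sequentially. C * (\<integral>x. tail_ramp k x \<partial>\<nu> n) < \<epsilon>"
    using k by (rule order_tendstoD(2))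
  have "(\<lambda>n. \<integral>x. g x \<partial>\<nu> n) \<longlonglongrightarrow> (\<integral>x. g x \<partial>\<mu>)"
    using integral_trig_poly_tendsto[OF g(1)]
    by (simp add: integral_complex_of_real tendsto_of_real_iff)
  then have ev2: "\<forall>\<^sub>F n in sequentially. \<bar>(\<integral>x. g x \<partial>\<nu> n) - (\<integral>x. g x \<partial>\<mu>)\<bar> < \<epsilon>"
    using \<open>\<epsilon> > 0\<close> by (auto simp: tendsto_iff dist_real_def)
  have "\<forall>\<^sub>F n in sequentially. \<bar>(\<integral>x. f x \<partial>\<nu> n) - (\<integral>x. f x \<partial>\<mu>)\<bar> < e"
    using ev1 ev2
  proof eventually_elim
    case (elim n)
    then show ?case
      using int_fg[OF prob_\<nu> sets_\<nu> integrable_tail_ramp(1), of n]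
        int_fg[OF prob_\<mu> sets_\<mu> integrable_tail_ramp(2)] k \<open>\<epsilon> > 0\<close>
      unfolding \<epsilon>_def by linarith
  qed
  then show "\<exists>no. \<forall>n\<ge>no. norm ((\<integral>x. f x \<partial>\<nu> n) - (\<integral>x. f x \<partial>\<mu>)) < e"
    by (auto simp: eventually_sequentially)
qed

end

section \<open>Weighted sums of i.i.d. random variables\<close>

text \<open>The upper estimate passes through 1 / (1 + y), using (1 - y + y^2)(1 + y) = 1 +
  y^3.\<close>

lemma exp_minus_approx:
  fixes y :: real
  assumes "0 \<le> y"
  shows "\<bar>exp (- y) - (1 - y)\<bar> \<le> y\<^sup>2"
proof -
  have "1 - y \<le> exp (- y)"
    using exp_ge_add_one_self[of "- y"] by simp
  moreover have "exp (- y) \<le> 1 - y + y\<^sup>2"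
  proof -
    have "exp (- y) = 1 / exp y"
      by (simp add: exp_minus inverse_eq_divide)
    also have "\<dots> \<le> 1 / (1 + y)"
      using assms by (intro divide_left_mono) (auto simp: exp_ge_add_one_self)
    also have "\<dots> \<le> 1 - y + y\<^sup>2"
    proof -
      have "(1 - y + y\<^sup>2) * (1 + y) = 1 + y ^ 3"
        by (simp add: algebra_simps power2_eq_square power3_eq_cube)
      then show ?thesis
        using assms by (simp add: divide_le_eq)
    qed
    finally show ?thesis .
  qed
  ultimately show ?thesis by linarith
qed

text \<open>Each factor of the characteristic function is compared with a Gaussian factor of the
  same variance. The errors are at most the squared weights times a quantity that vanishes uniformly
  as the weights shrink, so their sum tends to 0.\<close>

theorem (in prob_space) char_weighted_sum_tendsto:
  fixes X :: "'i \<Rightarrow> 'a \<Rightarrow> real" and c :: "nat \<Rightarrow> 'i \<Rightarrow> real" and A :: "nat \<Rightarrow> 'i set"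
  assumes indep: "indep_vars (\<lambda>_. borel) X UNIV"
    and mean_0: "\<And>i. expectation (X i) = 0"
    and square_integrable: "\<And>i. integrable M (\<lambda>x. (X i x)\<^sup>2)"
    and second_moment: "\<And>i. expectation (\<lambda>x. (X i x)\<^sup>2) = s"
    and distrib: "\<And>i. distr M borel (X i) = \<mu>"
    and weights_small: "\<And>n i. i \<in> A n \<Longrightarrow> \<bar>c n i\<bar> \<le> \<delta> n" "\<delta> \<longlonglongrightarrow> 0"
    and weights_square: "(\<lambda>n. \<Sum>i\<in>A n. (c n i)\<^sup>2) \<longlonglongrightarrow> v"
  shows "(\<lambda>n. char (distr M borel (\<lambda>\<omega>. \<Sum>i\<in>A n. c n i * X i \<omega>)) t) \<longlonglongrightarrow>
    complex_of_real (exp (- (t\<^sup>2 * v * s / 2)))"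
proof -
  have X_rv [simp, measurable]: "random_variable borel (X i)" for i
    using indep unfolding indep_vars_def2 by simp
  have X_integrable [simp]: "integrable M (X i)" for i
    by (rule square_integrable_imp_integrable[OF _ square_integrable]) simp_all
  \<comment> \<open>Any index serves as representative, since all the laws agree.\<close>
  have \<mu>_def: "\<mu> = distr M borel (X undefined)"
    by (simp add: distrib)
  interpret \<mu>: real_distribution \<mu>
    unfolding \<mu>_def by (rule real_distribution_distr) simp
  have \<mu>_facts [simp]: "integrable \<mu> (\<lambda>x. x)" "\<mu>.expectation (\<lambda>x. x) = 0"
    "integrable \<mu> (\<lambda>x. x\<^sup>2)" "\<mu>.expectation (\<lambda>x. x\<^sup>2) = s"
    using mean_0 square_integrable second_moment
    by (simp_all add: \<mu>_def integrable_distr_eq integral_distr)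
  have "0 \<le> \<mu>.expectation (\<lambda>x. x\<^sup>2)"
    by (intro integral_nonneg_AE) simp
  then have "0 \<le> s" by simp
  \<comment> \<open>The integrand in the remainder of \<open>char_approx3\<close>. The minimum keeps
    it integrable with only a second moment, while the cubic term makes it vanish pointwise as
    \<open>u\<close> tends to 0.\<close>
  define h where "h u x = min (6 * x\<^sup>2) (\<bar>u\<bar> * \<bar>x\<bar> ^ 3)" for u x :: real
  have h_integrable [simp]: "integrable \<mu> (h u)" for u
    unfolding h_def by (rule Bochner_Integration.integrable_bound[of _ "\<lambda>x. 6 * x\<^sup>2"]) auto
  \<comment> \<open>The two expansion errors, of the characteristic function and of the exponential,
    after dividing by \<open>u\<^sup>2\<close>.\<close>
  define r where "r u = \<mu>.expectation (h u) / 6 + u\<^sup>2 * s\<^sup>2 / 4" for u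
  have r_mono: "r u \<le> r w" if "\<bar>u\<bar> \<le> w" for u w
  proof -
    have "\<mu>.expectation (h u) \<le> \<mu>.expectation (h w)"
    proof (rule integral_mono)
      show "h u x \<le> h w x" for x
        unfolding h_def using that by (intro min.mono mult_right_mono) auto
    qed simp_all
    moreover have "u\<^sup>2 * s\<^sup>2 \<le> w\<^sup>2 * s\<^sup>2"
      using that power_mono[of "\<bar>u\<bar>" w 2] by (intro mult_right_mono) auto
    ultimately show ?thesis by (simp add: r_def)
  qed
  have char_exp: "cmod (char \<mu> u - exp (- (u\<^sup>2 * s / 2))) \<le> u\<^sup>2 * r u" for u
  proof -
    have "cmod (char \<mu> u - (1 - u\<^sup>2 * s / 2)) \<le> u\<^sup>2 / 6 * \<mu>.expectation (h u)"
      unfolding h_def by (rule \<mu>.char_approx3) auto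
    moreover have "cmod (complex_of_real (exp (- (u\<^sup>2 * s / 2)) - (1 - u\<^sup>2 * s / 2))) \<le> (u\<^sup>2 * s / 2)\<^sup>2"
      unfolding norm_of_real using \<open>0 \<le> s\<close> by (intro exp_minus_approx) auto
    ultimately have "cmod (char \<mu> u - exp (- (u\<^sup>2 * s / 2))) \<le>
        u\<^sup>2 / 6 * \<mu>.expectation (h u) + (u\<^sup>2 * s / 2)\<^sup>2"
      using norm_triangle_ineq4[of "char \<mu> u - (1 - u\<^sup>2 * s / 2)"
          "complex_of_real (exp (- (u\<^sup>2 * s / 2)) - (1 - u\<^sup>2 * s / 2))"]
      by simp
    also have "\<dots> = u\<^sup>2 * r u"
      by (simp add: r_def field_simps power2_eq_square)
    finally show ?thesis .
  qed
  have char_prod: "char (distr M borel (\<lambda>\<omega>. \<Sum>i\<in>A n. c n i * X i \<omega>)) t =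
      (\<Prod>i\<in>A n. char \<mu> (t * c n i))" for n
  proof -
    have "indep_vars (\<lambda>_. borel) (\<lambda>i \<omega>. c n i * X i \<omega>) (A n)"
      by (rule indep_vars_compose2[where X = X and M' = "\<lambda>_. borel"])
        (auto intro: indep_vars_subset[OF indep])
    then have "char (distr M borel (\<lambda>\<omega>. \<Sum>i\<in>A n. c n i * X i \<omega>)) t =
        (\<Prod>i\<in>A n. char (distr M borel (\<lambda>\<omega>. c n i * X i \<omega>)) t)"
      by (rule char_distr_sum)
    also have "\<dots> = (\<Prod>i\<in>A n. char \<mu> (t * c n i))"
    proof (rule prod.cong)
      show "char (distr M borel (\<lambda>\<omega>. c n i * X i \<omega>)) t = char \<mu> (t * c n i)" for i
        unfolding distrib[of i, symmetric] by (simp add: char_def integral_distr mult_ac)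
    qed simp
    finally show ?thesis .
  qed
  let ?V = "\<lambda>n. \<Sum>i\<in>A n. (c n i)\<^sup>2"
  have bound: "cmod ((\<Prod>i\<in>A n. char \<mu> (t * c n i)) - exp (- (t\<^sup>2 * ?V n * s / 2))) \<le>
      t\<^sup>2 * ?V n * r (\<bar>t\<bar> * \<delta> n)" for n
  proof (cases "finite (A n)")
    case True
    have "complex_of_real (exp (- (t\<^sup>2 * ?V n * s / 2))) =
        (\<Prod>i\<in>A n. complex_of_real (exp (- ((t * c n i)\<^sup>2 * s / 2))))"
      using True
      by (simp add: exp_sum[symmetric] sum_negf sum_distrib_left sum_distrib_right
          sum_divide_distrib power_mult_distrib flip: of_real_prod)
    \<comment> \<open>All factors lie in the closed unit disc, so telescoping bounds the difference
      of the products by the sum of the differences.\<close>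
    then have "cmod ((\<Prod>i\<in>A n. char \<mu> (t * c n i)) - exp (- (t\<^sup>2 * ?V n * s / 2))) \<le>
        (\<Sum>i\<in>A n. cmod (char \<mu> (t * c n i) - exp (- ((t * c n i)\<^sup>2 * s / 2))))"
      using \<open>0 \<le> s\<close> by (simp only:) (intro norm_prod_diff, auto simp: \<mu>.cmod_char_le_1)
    also have "\<dots> \<le> (\<Sum>i\<in>A n. (t * c n i)\<^sup>2 * r (\<bar>t\<bar> * \<delta> n))"
    proof (rule sum_mono)
      fix i assume "i \<in> A n"
      then have "\<bar>t * c n i\<bar> \<le> \<bar>t\<bar> * \<delta> n"
        unfolding abs_mult by (intro mult_left_mono weights_small) auto
      then have "(t * c n i)\<^sup>2 * r (t * c n i) \<le> (t * c n i)\<^sup>2 * r (\<bar>t\<bar> * \<delta> n)"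
        by (intro mult_left_mono r_mono) auto
      with char_exp[of "t * c n i"]
      show "cmod (char \<mu> (t * c n i) - exp (- ((t * c n i)\<^sup>2 * s / 2))) \<le>
          (t * c n i)\<^sup>2 * r (\<bar>t\<bar> * \<delta> n)"
        by linarith
    qed
    also have "\<dots> = t\<^sup>2 * ?V n * r (\<bar>t\<bar> * \<delta> n)"
      by (simp add: power_mult_distrib sum_distrib_left sum_distrib_right)
    finally show ?thesis .
  \<comment> \<open>For infinite \<open>A n\<close> the product is 1 and the sum \<open>?V n\<close>
    is 0 by convention, so both sides vanish.\<close>
  qed simp
  have "(\<lambda>n. \<mu>.expectation (h (\<bar>t\<bar> * \<delta> n))) \<longlonglongrightarrow> \<mu>.expectation (\<lambda>x. 0)"
  proof (rule integral_dominated_convergence[where w = "\<lambda>x. 6 * x\<^sup>2"])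
    have "(\<lambda>n. h (\<bar>t\<bar> * \<delta> n) x) \<longlonglongrightarrow> min (6 * x\<^sup>2) (\<bar>\<bar>t\<bar> * 0\<bar> * \<bar>x\<bar> ^ 3)" for x
      unfolding h_def by (intro tendsto_intros tendsto_min weights_small)
    then show "AE x in \<mu>. (\<lambda>n. h (\<bar>t\<bar> * \<delta> n) x) \<longlonglongrightarrow> 0"
      by (simp add: min_absorb2)
    show "h (\<bar>t\<bar> * \<delta> n) \<in> borel_measurable \<mu>" for n
      by (rule borel_measurable_integrable) simp
  qed (auto simp: h_def)
  then have "(\<lambda>n. \<mu>.expectation (h (\<bar>t\<bar> * \<delta> n)) / 6 + (\<bar>t\<bar> * \<delta> n)\<^sup>2 * s\<^sup>2 / 4) \<longlonglongrightarrow>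
      0 / 6 + (\<bar>t\<bar> * 0)\<^sup>2 * s\<^sup>2 / 4"
    by (intro tendsto_intros weights_small) auto
  then have "(\<lambda>n. r (\<bar>t\<bar> * \<delta> n)) \<longlonglongrightarrow> 0"
    by (simp add: r_def)
  then have "(\<lambda>n. t\<^sup>2 * ?V n * r (\<bar>t\<bar> * \<delta> n)) \<longlonglongrightarrow> t\<^sup>2 * v * 0"
    by (intro tendsto_intros weights_square)
  then have diff: "(\<lambda>n. (\<Prod>i\<in>A n. char \<mu> (t * c n i)) - exp (- (t\<^sup>2 * ?V n * s / 2))) \<longlonglongrightarrow> 0"
    by (intro Lim_null_comparison[OF always_eventually[OF allI[OF bound]]]) simp
  have "(\<lambda>n. complex_of_real (exp (- (t\<^sup>2 * ?V n * s / 2)))) \<longlonglongrightarrow>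
      complex_of_real (exp (- (t\<^sup>2 * v * s / 2)))"
    by (intro tendsto_intros weights_square) auto
  from tendsto_add[OF diff this] show ?thesis
    by (simp add: char_prod)
qed

section \<open>The multivariate normal distribution\<close>

lemma inner_axis_matrix_axis:
  fixes K :: "real ^ 'n ^ 'n"
  shows "axis i 1 \<bullet> (K *v axis j 1) = K $ i $ j"
  by (simp add: matrix_vector_mult_basis column_def inner_axis')

lemma symmetric_matrix_inner_commute:
  fixes K :: "real ^ 'n ^ 'n"
  assumes "transpose K = K"
  shows "x \<bullet> (K *v y) = y \<bullet> (K *v x)"
  by (metis assms dot_lmul_matrix inner_commute transpose_matrix_vector)

text \<open>
  Elimination as in Cholesky's algorithm: a nonzero diagonal entry is cleared by subtracting a
  rank-one matrix, and a vanishing one forces its whole row to vanish.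
\<close>

lemma psd_sum_rank_one:
  fixes K :: "real ^ 'n ^ 'n"
  assumes "finite S" "transpose K = K" "\<And>x. 0 \<le> x \<bullet> (K *v x)"
    and "\<And>i j. i \<notin> S \<Longrightarrow> K $ i $ j = 0"
  shows "\<exists>v :: 'n \<Rightarrow> real ^ 'n. \<forall>i j. K $ i $ j = (\<Sum>k\<in>S. v k $ i * v k $ j)"
  using assms
proof (induction S arbitrary: K rule: finite_induct)
  case empty
  then show ?case by simp
next
  case (insert k S)
  note sym = symmetric_matrix_inner_commute[OF insert.prems(1)]
  have K_commute: "K $ i $ j = K $ j $ i" for i j
    using sym[of "axis i 1" "axis j 1"] by (simp add: inner_axis_matrix_axis)
  \<comment> \<open>The quadratic form along the line through \<open>x\<close> in direction
    \<open>axis k 1\<close>, as a polynomial in \<open>s\<close>.\<close>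
  have quad: "0 \<le> x \<bullet> (K *v x) + 2 * s * (x \<bullet> (K *v axis k 1)) + s\<^sup>2 * K $ k $ k" for x s
  proof -
    have "0 \<le> (x + s *\<^sub>R axis k 1) \<bullet> (K *v (x + s *\<^sub>R axis k 1))"
      by (rule insert.prems(2))
    also have "\<dots> = x \<bullet> (K *v x) + 2 * s * (x \<bullet> (K *v axis k 1)) + s\<^sup>2 * K $ k $ k"
      using sym[of x "axis k 1"]
      by (simp add: matrix_vector_right_distrib matrix_vector_mult_scaleR inner_add_left
          inner_add_right inner_axis_matrix_axis power2_eq_square algebra_simps)
    finally show ?thesis .
  qed
  have "0 \<le> K $ k $ k"
    using insert.prems(2)[of "axis k 1"] by (simp add: inner_axis_matrix_axis)
  then consider "K $ k $ k = 0" | "K $ k $ k > 0"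
    by linarith
  then show ?case
  proof cases
    case 1
    have "K $ i $ k = 0" for i
    proof (rule ccontr)
      assume "K $ i $ k \<noteq> 0"
      \<comment> \<open>With the \<open>s\<^sup>2\<close> term gone the polynomial is affine; this
        \<open>s\<close> gives it the value -1.\<close>
      with quad[of "axis i 1" "- (K $ i $ i + 1) / (2 * K $ i $ k)"] 1
      show False by (simp add: inner_axis_matrix_axis field_simps)
    qed
    then have "K $ i $ j = 0" if "i \<notin> S" for i j
      using insert.prems(3)[of i j] that K_commute by (cases "i = k") auto
    then obtain v :: "'n \<Rightarrow> real ^ 'n" where "\<forall>i j. K $ i $ j = (\<Sum>k\<in>S. v k $ i * v k $ j)"
      using insert.IH[OF insert.prems(1,2)] by blast
    then show ?thesis
      using insert.hyps by (intro exI[of _ "v(k := 0)"]) (auto intro!: sum.cong)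
  next
    case 2
    \<comment> \<open>Scaled so that the rank-one matrix of \<open>w\<close> agrees with
      \<open>K\<close> in row and column \<open>k\<close>.\<close>
    define w where "w = (1 / sqrt (K $ k $ k)) *\<^sub>R (K *v axis k 1)"
    define K' :: "real ^ 'n ^ 'n" where "K' = (\<chi> i j. K $ i $ j - w $ i * w $ j)"
    have w: "w $ i = K $ i $ k / sqrt (K $ k $ k)" for i
      by (simp add: w_def matrix_vector_mult_basis column_def)
    have K': "K' *v x = K *v x - (w \<bullet> x) *\<^sub>R w" for x
      by (simp add: K'_def vec_eq_iff matrix_vector_mult_def inner_vec_def right_diff_distrib left_diff_distrib
          sum_subtractf sum_distrib_left sum_distrib_right mult_ac)
    have "0 \<le> x \<bullet> (K' *v x)" for x
    proof -
      have "x \<bullet> (K' *v x) = x \<bullet> (K *v x) - (x \<bullet> w)\<^sup>2"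
        by (simp add: K' inner_diff_right inner_commute power2_eq_square)
      also have "(x \<bullet> w)\<^sup>2 = (x \<bullet> (K *v axis k 1))\<^sup>2 / K $ k $ k"
        using 2 by (simp add: w_def power_divide)
      finally show ?thesis
        \<comment> \<open>The minimiser in \<open>s\<close>; the minimum is exactly the form of the
          Schur complement \<open>K'\<close>.\<close>
        using quad[of x "- (x \<bullet> (K *v axis k 1)) / K $ k $ k"] 2
        by (simp add: power2_eq_square)
    qed
    moreover have "transpose K' = K'"
      using K_commute by (simp add: K'_def transpose_def vec_eq_iff)
    moreover have "K' $ i $ j = 0" if "i \<notin> S" for i j
    proof (cases "i = k")
      case True
      then show ?thesis
        using 2 K_commute[of k j] by (simp add: K'_def w)
    next
      case False
      then show ?thesis
        using that insert.prems(3)[of i] by (simp add: K'_def w)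
    qed
    ultimately obtain v :: "'n \<Rightarrow> real ^ 'n"
      where v: "\<forall>i j. K' $ i $ j = (\<Sum>k\<in>S. v k $ i * v k $ j)"
      using insert.IH[of K'] by blast
    have "K $ i $ j = (\<Sum>l\<in>insert k S. (v(k := w)) l $ i * (v(k := w)) l $ j)" for i j
    proof -
      have "K $ i $ j = w $ i * w $ j + (\<Sum>l\<in>S. v l $ i * v l $ j)"
        using v[rule_format, of i j, symmetric] by (simp add: K'_def)
      also have "\<dots> = (\<Sum>l\<in>insert k S. (v(k := w)) l $ i * (v(k := w)) l $ j)"
        using insert.hyps by (auto intro!: sum.cong)
      finally show ?thesis .
    qed
    then show ?thesis by blast
  qed
qed

text \<open>The vectors of the rank-one decomposition become the columns of \<open>A\<close>. This
  ensures that the choice in \<open>multivariate_normal\<close> is made from a nonempty set.\<close>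

lemma psd_factorization:
  fixes K :: "real ^ 'n ^ 'n"
  assumes "transpose K = K" "\<And>x. 0 \<le> x \<bullet> (K *v x)"
  obtains A :: "real ^ 'n ^ 'n" where "A ** transpose A = K"
proof -
  obtain v :: "'n \<Rightarrow> real ^ 'n" where "\<forall>i j. K $ i $ j = (\<Sum>k\<in>UNIV. v k $ i * v k $ j)"
    using psd_sum_rank_one[OF _ assms, of UNIV] by auto
  then have "(\<chi> i k. v k $ i) ** transpose (\<chi> i k. v k $ i) = K"
    by (simp add: matrix_matrix_mult_def transpose_def vec_eq_iff)
  then show thesis by (rule that)
qed

section \<open>The normal law: measurability and characteristic function\<close>

lemma cis_sum: "finite S \<Longrightarrow> cis (\<Sum>i\<in>S. f i) = (\<Prod>i\<in>S. cis (f i))"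
  by (induction S rule: finite_induct) (auto simp: cis_mult[symmetric])

lemma vec_lambda_measurable [measurable]:
  "(\<lambda>z. \<chi> i. z i) \<in> (Pi\<^sub>M UNIV (\<lambda>_ :: 'n::finite. std_normal_distribution)) \<rightarrow>\<^sub>M (borel :: (real ^ 'n) measure)"
proof (subst borel_measurable_euclidean_space, intro ballI)
  fix b :: "real ^ 'n" assume "b \<in> Basis"
  then obtain k where "b = axis k 1"
    by (auto simp: Basis_vec_def)
  then show "(\<lambda>z. (\<chi> i. z i) \<bullet> b) \<in> borel_measurable (Pi\<^sub>M UNIV (\<lambda>_ :: 'n. std_normal_distribution))"
    by (simp add: inner_axis)
qed

lemma multivariate_normal_map_measurable [measurable]:
  fixes m :: "real ^ 'n"
  shows "(\<lambda>z. m + A *v (\<chi> i. z i)) \<in>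
    Pi\<^sub>M UNIV (\<lambda>_ :: 'n. std_normal_distribution) \<rightarrow>\<^sub>M borel"
proof -
  have [measurable]: "(\<lambda>x. m + A *v x) \<in> borel_measurable borel"
    by (intro borel_measurable_continuous_onI continuous_intros)
  show ?thesis by measurable
qed

lemma prob_space_multivariate_normal: "prob_space (multivariate_normal m (K :: real ^ 'n ^ 'n))"
  unfolding multivariate_normal_def Let_def
  by (intro prob_space.prob_space_distr prob_space_PiM multivariate_normal_map_measurable
      real_distribution.axioms(1) real_dist_normal_dist)

lemma sets_multivariate_normal: "sets (multivariate_normal m K) = sets borel"
  by (simp add: multivariate_normal_def Let_def)

text \<open>With a the image of \<open>u\<close> under the transpose of \<open>A\<close>, the
  exponent is the inner product of a with independent standard normals. Only the squared norm of a
  survives, which is the form of \<open>K\<close> at \<open>u\<close>, whatever \<open>A\<close> was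
  chosen.\<close>

lemma char_multivariate_normal_0:
  fixes K :: "real ^ 'n ^ 'n"
  assumes "transpose K = K" "\<And>x. 0 \<le> x \<bullet> (K *v x)"
  shows "(\<integral>x. cis (u \<bullet> x) \<partial>multivariate_normal 0 K) = of_real (exp (- (u \<bullet> (K *v u)) / 2))"
proof -
  define A where "A = (SOME A :: real ^ 'n ^ 'n. A ** transpose A = K)"
  have A: "A ** transpose A = K"
    unfolding A_def by (rule psd_factorization[OF assms]) (rule someI)
  interpret N: real_distribution std_normal_distribution
    by (rule real_dist_normal_dist)
  interpret product_sigma_finite "\<lambda>_ :: 'n. std_normal_distribution"
    by unfold_locales
  define a where "a = u v* A"
  have [measurable]: "(\<lambda>x. cis (u \<bullet> x)) \<in> borel_measurable borel"
    by (intro borel_measurable_continuous_onI continuous_on_cis continuous_intros)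
  have "(\<integral>x. cis (u \<bullet> x) \<partial>multivariate_normal 0 K) =
      (\<integral>z. cis (u \<bullet> (A *v (\<chi> i. z i))) \<partial>Pi\<^sub>M UNIV (\<lambda>_ :: 'n. std_normal_distribution))"
    unfolding multivariate_normal_def Let_def A_def[symmetric]
    by (subst integral_distr[OF multivariate_normal_map_measurable]) auto
  also have "\<dots> = (\<integral>z. (\<Prod>i\<in>UNIV. cis (a $ i * z i)) \<partial>Pi\<^sub>M UNIV (\<lambda>_ :: 'n. std_normal_distribution))"
    unfolding dot_lmul_matrix[symmetric] a_def[symmetric] by (simp add: inner_vec_def cis_sum)
  also have "\<dots> = (\<Prod>i\<in>UNIV. \<integral>x. cis (a $ i * x) \<partial>std_normal_distribution)"
    by (intro product_integral_prod N.integrable_const_bound[where B = 1])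
      (auto intro!: borel_measurable_continuous_onI continuous_on_cis continuous_intros)
  also have "\<dots> = (\<Prod>i\<in>UNIV. of_real (exp (- ((a $ i)\<^sup>2) / 2)))"
    using char_std_normal_distribution by (simp add: char_def fun_eq_iff cis_conv_exp)
  also have "\<dots> = of_real (exp (- (a \<bullet> a) / 2))"
    by (simp add: exp_sum[symmetric] inner_vec_def sum_negf sum_divide_distrib power2_eq_square
        flip: of_real_prod)
  also have "a \<bullet> a = u \<bullet> (K *v u)"
    by (simp add: a_def dot_lmul_matrix A[symmetric] matrix_vector_mul_assoc[symmetric])
  finally show ?thesis .
qed

section \<open>The centre of mass\<close>

text \<open>The increment \<open>X i\<close> occurs in the walk at times i to m. In the induction,
  passing to \<open>Suc m\<close> raises every weight by one, which adds one more copy of the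
  walk.\<close>

lemma sum_random_walk:
  "(\<Sum>i = 1..m. random_walk X i \<omega>) = (\<Sum>i = 1..m. (real m + 1 - real i) *\<^sub>R X i \<omega>)"
proof (induction m)
  case (Suc m)
  have "(\<Sum>i = 1..Suc m. (real (Suc m) + 1 - real i) *\<^sub>R X i \<omega>) =
      (\<Sum>i = 1..m. ((real m + 1 - real i) + 1) *\<^sub>R X i \<omega>) + X (Suc m) \<omega>"
  proof -
    have "real (Suc m) + 1 - real i = (real m + 1 - real i) + 1" for i
      by simp
    then show ?thesis
      by (simp only:) simp
  qed
  also have "\<dots> = (\<Sum>i = 1..m. (real m + 1 - real i) *\<^sub>R X i \<omega>) + random_walk X (Suc m) \<omega>"
    by (simp only: scaleR_left_distrib sum.distrib random_walk_def) simp
  finally show ?case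
    using Suc by simp
qed simp

definition com_weight :: "nat \<Rightarrow> nat \<Rightarrow> real" where
  "com_weight m i = (real m + 1 - real i) / real m"

lemma centre_of_mass_eq:
  "centre_of_mass X m \<omega> = (\<Sum>i = 1..m. com_weight m i *\<^sub>R X i \<omega>)"
  unfolding centre_of_mass_def sum_random_walk com_weight_def
  by (simp add: scaleR_sum_right)

lemma abs_com_weight_le:
  assumes "i \<in> {1..m}"
  shows "\<bar>com_weight m i\<bar> \<le> 1"
  using assms by (simp add: com_weight_def abs_le_iff divide_simps)

text \<open>Reversing the index turns the numerators into 1 to m, leaving the sum of the first m
  squares over m^2.\<close>

lemma sum_com_weight_square:
  assumes "m > 0"
  shows "(\<Sum>i = 1..m. (com_weight m i)\<^sup>2) = real m / 3 + 1 / 2 + 1 / (6 * real m)"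
proof -
  have squares: "(\<Sum>i = 1..k. (real i)\<^sup>2) = real k * (real k + 1) * (2 * real k + 1) / 6" for k
    by (induction k) (auto simp: field_simps power2_eq_square)
  have "(\<Sum>i = 1..m. (com_weight m i)\<^sup>2) = (\<Sum>i = 1..m. (real m + 1 - real i)\<^sup>2) / (real m)\<^sup>2"
    by (simp add: com_weight_def power_divide sum_divide_distrib)
  also have "(\<Sum>i = 1..m. (real m + 1 - real i)\<^sup>2) = (\<Sum>i = 1..m. (real i)\<^sup>2)"
    by (subst sum.atLeastAtMost_rev) (auto intro!: sum.cong simp: of_nat_diff)
  also have "\<dots> / (real m)\<^sup>2 = real m / 3 + 1 / 2 + 1 / (6 * real m)"
    using assms unfolding squares by (simp add: field_simps power2_eq_square)
  finally show ?thesis .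
qed

lemma sum_scaled_com_weight_square_tendsto:
  assumes "0 \<le> t"
  shows "(\<lambda>n. \<Sum>i = 1..nat \<lfloor>real n * t\<rfloor>. (com_weight (nat \<lfloor>real n * t\<rfloor>) i / sqrt (real n))\<^sup>2)
    \<longlonglongrightarrow> t / 3"
proof (rule Lim_transform[OF tendsto_const], rule Lim_null_comparison)
  show "(\<lambda>n. 2 / real n) \<longlonglongrightarrow> 0"
    by (rule lim_const_over_n)
  have "\<bar>(\<Sum>i = 1..nat \<lfloor>real n * t\<rfloor>. (com_weight (nat \<lfloor>real n * t\<rfloor>) i / sqrt (real n))\<^sup>2) - t / 3\<bar> \<le> 2 / real n"
    if "n > 0" for n
  proof -
    define m where "m = nat \<lfloor>real n * t\<rfloor>"
    have m: "real m \<le> real n * t" "real n * t < real m + 1"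
      using assms unfolding m_def by (auto simp: of_nat_nat)
    define V where "V = (\<Sum>i = 1..m. (com_weight m i)\<^sup>2)"
    \<comment> \<open>The excess is at most 1/2 + 1/6. Rounding down changes
      \<open>real n * t / 3\<close> by less than 1/3, so the total error before dividing by
      \<open>n\<close> is bounded by 2. The case \<open>m = 0\<close> covers an empty sum, in
      particular \<open>t = 0\<close>.\<close>
    have "0 \<le> V - real m / 3 \<and> V - real m / 3 \<le> 1"
    proof (cases "m = 0")
      case False
      then have V_eq: "V = real m / 3 + 1 / 2 + 1 / (6 * real m)"
        unfolding V_def by (intro sum_com_weight_square) simp
      have "0 \<le> 1 / (6 * real m)" "1 / (6 * real m) \<le> 1 / 6"
        using False by (auto simp: divide_le_eq)
      then show ?thesis
        unfolding V_eq by linarith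
    qed (simp add: V_def)
    with m have "\<bar>V - real n * t / 3\<bar> \<le> 2"
      by linarith
    moreover have "V / real n - t / 3 = (V - real n * t / 3) / real n"
      using that by (simp add: field_simps)
    ultimately have "\<bar>V / real n - t / 3\<bar> \<le> 2 / real n"
      by (simp add: divide_right_mono)
    then show ?thesis
      by (simp add: m_def[symmetric] V_def power_divide sum_divide_distrib)
  qed
  then show "\<forall>\<^sub>F n in sequentially. norm
      ((\<Sum>i = 1..nat \<lfloor>real n * t\<rfloor>. (com_weight (nat \<lfloor>real n * t\<rfloor>) i / sqrt (real n))\<^sup>2) - t / 3) \<le> 2 / real n"
    by (auto simp: eventually_sequentially intro!: exI[of _ 1])
qed

section \<open>The second-moment matrix\<close>

lemma outer_product_mult_vec: "outer_product x *v y = (x \<bullet> y) *\<^sub>R x"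
  by (simp add: outer_product_def matrix_vector_mult_def vec_eq_iff inner_vec_def
      sum_distrib_left sum_distrib_right mult_ac)

text \<open>The matrix norm here is the Frobenius norm; the identity makes the outer product
  integrable as soon as the squared norm is.\<close>

lemma norm_outer_product: "norm (outer_product x) = (norm x)\<^sup>2"
proof -
  have "outer_product x \<bullet> outer_product x = (x \<bullet> x)\<^sup>2"
    by (simp add: outer_product_def inner_vec_def power2_eq_square sum_product mult_ac)
  then show ?thesis
    by (simp add: norm_eq_sqrt_inner[of "outer_product x"] power2_norm_eq_inner)
qed

lemma continuous_on_outer_product: "continuous_on S outer_product"
  unfolding outer_product_def by (intro continuous_intros)

context
  fixes M :: "'s measure" and \<xi> :: "'s \<Rightarrow> real ^ 'd"
  assumes \<xi> [measurable]: "\<xi> \<in> borel_measurable M"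
    and square_integrable: "integrable M (\<lambda>\<omega>. (norm (\<xi> \<omega>))\<^sup>2)"
begin

lemma integrable_outer_product: "integrable M (\<lambda>\<omega>. outer_product (\<xi> \<omega>))"
proof (rule Bochner_Integration.integrable_bound[OF square_integrable])
  show "(\<lambda>\<omega>. outer_product (\<xi> \<omega>)) \<in> borel_measurable M"
    by (rule measurable_compose[OF \<xi>])
      (intro borel_measurable_continuous_onI continuous_on_outer_product)
qed (simp add: norm_outer_product)

lemma transpose_second_moment:
  "transpose (\<integral>\<omega>. outer_product (\<xi> \<omega>) \<partial>M) = (\<integral>\<omega>. outer_product (\<xi> \<omega>) \<partial>M)"
proof -
  have "bounded_linear (transpose :: real ^ 'd ^ 'd \<Rightarrow> _)"
    unfolding linear_conv_bounded_linear[symmetric]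
    by (intro linearI) (simp_all add: transpose_def vec_eq_iff)
  from integral_bounded_linear[OF this integrable_outer_product] show ?thesis
    by (simp add: outer_product_def transpose_def mult.commute)
qed

text \<open>For fixed \<open>u\<close> the form is linear in the matrix, so it commutes with the
  integral. This reduces the matrix to variances of scalar projections.\<close>

lemma second_moment_quadratic_form:
  "u \<bullet> ((\<integral>\<omega>. outer_product (\<xi> \<omega>) \<partial>M) *v u) = (\<integral>\<omega>. (u \<bullet> \<xi> \<omega>)\<^sup>2 \<partial>M)"
proof -
  have "bounded_linear (\<lambda>B :: real ^ 'd ^ 'd. u \<bullet> (B *v u))"
    unfolding linear_conv_bounded_linear[symmetric]
    by (intro linearI)
      (simp_all add: matrix_vector_mult_add_rdistrib inner_add_right scaleR_matrix_vector_assoc[symmetric])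
  from integral_bounded_linear[OF this integrable_outer_product] show ?thesis
    by (simp add: outer_product_mult_vec inner_commute power2_eq_square)
qed

end

section \<open>The central limit theorem for the centre of mass\<close>

theorem theorem7p2:
  fixes M :: "'s measure"
    and \<xi> :: "'s \<Rightarrow> real ^ 'd"
    and X :: "nat \<Rightarrow> 's \<Rightarrow> real ^ 'd"
    and \<Sigma> :: "real ^ 'd ^ 'd"
    and t :: real
  assumes "prob_space M"
    and "iid M X"
    and "X 0 = \<xi>"
    and "integral\<^sup>L M \<xi> = 0"
    and "integrable M (\<lambda>\<omega>. (norm (\<xi> \<omega>))\<^sup>2)"
    and "\<Sigma> = integral\<^sup>L M (\<lambda>\<omega>. outer_product (\<xi> \<omega>))"
    and "0 \<le> t" and "t \<le> 1"
  shows "converges_in_distribution M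
           (\<lambda>n \<omega>. (1 / sqrt (real n)) *\<^sub>R centre_of_mass X (nat \<lfloor>real n * t\<rfloor>) \<omega>)
           (multivariate_normal 0 ((t / 3) *\<^sub>R \<Sigma>))"
proof -
  interpret prob_space M by fact
  have indep: "indep_vars (\<lambda>_. borel) X UNIV" and distr_eq: "distr M borel (X i) = distr M borel \<xi>" for i
    using \<open>iid M X\<close> \<open>X 0 = \<xi>\<close> by (auto simp: iid_def)
  have X_rv [measurable]: "X i \<in> borel_measurable M" for i
    using indep by (auto simp: indep_vars_def2)
  have \<xi>_rv [measurable]: "\<xi> \<in> borel_measurable M"
    using X_rv[of 0] \<open>X 0 = \<xi>\<close> by simp
  have \<xi>_integrable: "integrable M \<xi>"
  proof -
    have "integrable M (\<lambda>\<omega>. norm (\<xi> \<omega>))"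
      by (rule square_integrable_imp_integrable) (use assms(5) in auto)
    then show ?thesis by (simp add: integrable_norm_iff)
  qed
  define K where "K = (t / 3) *\<^sub>R \<Sigma>"
  have K_quadratic: "u \<bullet> (K *v u) = (t / 3) * (\<integral>\<omega>. (u \<bullet> \<xi> \<omega>)\<^sup>2 \<partial>M)" for u
    using second_moment_quadratic_form[OF \<xi>_rv assms(5)]
    by (simp add: K_def assms(6) scaleR_matrix_vector_assoc[symmetric])
  have K_psd: "0 \<le> u \<bullet> (K *v u)" for u
    unfolding K_quadratic using \<open>0 \<le> t\<close> by (intro mult_nonneg_nonneg integral_nonneg_AE) auto
  have K_sym: "transpose K = K"
    using transpose_second_moment[OF \<xi>_rv assms(5)]
    by (simp add: K_def assms(6) transpose_scalar)
  define m where "m n = nat \<lfloor>real n * t\<rfloor>" for n :: nat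
  define Y where "Y n \<omega> = (1 / sqrt (real n)) *\<^sub>R centre_of_mass X (m n) \<omega>" for n \<omega>
  define c where "c n i = com_weight (m n) i / sqrt (real n)" for n i
  have Y_eq: "Y n \<omega> = (\<Sum>i = 1..m n. c n i *\<^sub>R X i \<omega>)" for n \<omega>
    by (simp add: Y_def c_def centre_of_mass_eq scaleR_sum_right)
  have Y_rv [measurable]: "Y n \<in> borel_measurable M" for n
    unfolding Y_eq[abs_def] by measurable
  \<comment> \<open>The walk sums from index 1, while \<open>X 0\<close> is the generic copy
    carrying the moment assumptions; equality of laws moves them to every increment.\<close>
  have transfer: "integrable M (\<lambda>\<omega>. f (X i \<omega>)) = integrable M (\<lambda>\<omega>. f (\<xi> \<omega>))"
    "(\<integral>\<omega>. f (X i \<omega>) \<partial>M) = (\<integral>\<omega>. f (\<xi> \<omega>) \<partial>M)"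
    if [measurable]: "f \<in> borel_measurable borel" for f :: "real ^ 'd \<Rightarrow> real" and i
    using distr_eq[of i] integral_distr[OF X_rv that, of i] integral_distr[OF \<xi>_rv that]
      integrable_distr_eq[OF X_rv that, of i] integrable_distr_eq[OF \<xi>_rv that]
    by simp_all
  interpret char_convergence "\<lambda>n. distr M borel (Y n)" "multivariate_normal 0 K"
  proof (rule char_convergence.intro)
    fix u :: "real ^ 'd"
    have [measurable]: "(\<lambda>x. u \<bullet> x) \<in> borel_measurable borel" "(\<lambda>x. (u \<bullet> x)\<^sup>2) \<in> borel_measurable borel"
      by measurable
    \<comment> \<open>The direction \<open>u\<close> is absorbed into the scalar variables, so the
      characteristic function is taken at 1.\<close>
    have "(\<lambda>n. char (distr M borel (\<lambda>\<omega>. \<Sum>i\<in>{1..m n}. c n i * (u \<bullet> X i \<omega>))) 1) \<longlonglongrightarrow>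
        complex_of_real (exp (- (1\<^sup>2 * (t / 3) * (\<integral>\<omega>. (u \<bullet> \<xi> \<omega>)\<^sup>2 \<partial>M) / 2)))"
    proof (rule char_weighted_sum_tendsto)
      show "indep_vars (\<lambda>_. borel) (\<lambda>i \<omega>. u \<bullet> X i \<omega>) UNIV"
        by (rule indep_vars_compose2[OF indep]) simp
      show "expectation (\<lambda>\<omega>. u \<bullet> X i \<omega>) = 0" for i
        using transfer(2)[of "\<lambda>x. u \<bullet> x" i] \<xi>_integrable assms(4) by simp
      show "integrable M (\<lambda>\<omega>. (u \<bullet> X i \<omega>)\<^sup>2)" for i
      proof -
        have "integrable M (\<lambda>\<omega>. (u \<bullet> \<xi> \<omega>)\<^sup>2)"
        proof (rule Bochner_Integration.integrable_bound)
          show "integrable M (\<lambda>\<omega>. (norm u)\<^sup>2 * (norm (\<xi> \<omega>))\<^sup>2)"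
            using assms(5) by simp
          show "AE \<omega> in M. norm ((u \<bullet> \<xi> \<omega>)\<^sup>2) \<le> norm ((norm u)\<^sup>2 * (norm (\<xi> \<omega>))\<^sup>2)"
            using Cauchy_Schwarz_ineq2
            by (auto simp: power_mult_distrib[symmetric] abs_le_square_iff[symmetric])
        qed simp
        then show ?thesis
          using transfer(1)[of "\<lambda>x. (u \<bullet> x)\<^sup>2" i] by simp
      qed
      show "expectation (\<lambda>\<omega>. (u \<bullet> X i \<omega>)\<^sup>2) = (\<integral>\<omega>. (u \<bullet> \<xi> \<omega>)\<^sup>2 \<partial>M)" for i
        by (rule transfer(2)) measurable
      show "distr M borel (\<lambda>\<omega>. u \<bullet> X i \<omega>) = distr (distr M borel \<xi>) borel (\<lambda>x. u \<bullet> x)" for i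
        unfolding distr_eq[of i, symmetric] by (simp add: distr_distr comp_def)
      \<comment> \<open>Averaging keeps each weight at most 1, so the scaling alone makes them
        uniformly small.\<close>
      show "\<bar>c n i\<bar> \<le> 1 / sqrt (real n)" if "i \<in> {1..m n}" for n i
        using abs_com_weight_le[OF that] by (simp add: c_def divide_right_mono)
      show "(\<lambda>n. 1 / sqrt (real n)) \<longlonglongrightarrow> 0"
        using tendsto_real_sqrt[OF lim_1_over_n] by (simp add: real_sqrt_divide)
      show "(\<lambda>n. \<Sum>i = 1..m n. (c n i)\<^sup>2) \<longlonglongrightarrow> t / 3"
        unfolding c_def m_def by (rule sum_scaled_com_weight_square_tendsto[OF \<open>0 \<le> t\<close>])
    qed
    moreover have "char (distr M borel (\<lambda>\<omega>. \<Sum>i\<in>{1..m n}. c n i * (u \<bullet> X i \<omega>))) 1 =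
        (\<integral>x. cis (u \<bullet> x) \<partial>distr M borel (Y n))" for n
    proof -
      have "(\<integral>x. cis (u \<bullet> x) \<partial>distr M borel (Y n)) = (\<integral>\<omega>. cis (u \<bullet> Y n \<omega>) \<partial>M)"
        by (intro integral_distr Y_rv borel_measurable_continuous_onI continuous_on_cis continuous_intros)
      then show ?thesis
        by (simp add: char_def integral_distr Y_eq inner_sum_right cis_conv_exp)
    qed
    ultimately show "(\<lambda>n. \<integral>x. cis (u \<bullet> x) \<partial>distr M borel (Y n)) \<longlonglongrightarrow>
        (\<integral>x. cis (u \<bullet> x) \<partial>multivariate_normal 0 K)"
      using char_multivariate_normal_0[OF K_sym K_psd, of u] by (simp add: K_quadratic)
  qed (simp_all add: prob_space_distr prob_space_multivariate_normal sets_multivariate_normal)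
  show ?thesis
    using integral_bounded_continuous_tendsto
    unfolding converges_in_distribution_def Y_def m_def K_def by blast
qed

end
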